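(* Let $G$ be a finitely generated abelian group. If $G$ is torsion-free, then $\mathrm{rk}_S(G) = \mathrm{rk}_G(G)+1$; otherwise $\mathrm{rk}_S(G) = \mathrm{rk}_G(G)$.
   Context: For a subset $X$ of a group $G$, $X^+$ denotes the subsemigroup of $G$ generated by $X$ (all products of one or more elements of $X$; $\emptyset^+=\emptyset$) and $\langle X\rangle$ the subgroup generated by $X$. For a finitely generated group $G$, the semigroup rank is $\mathrm{rk}_S(G)=\min\{|X| : X\subseteq G,\ X^+=G\}$ and the group rank is $\mathrm{rk}_G(G)=\min\{|X| : X\subseteq G,\ \langle X\rangle=G\}$. A group is torsion-free if its only element of finite order is the identity (so the trivial group is torsion-free). *)

theory Defs
  imports "HOL-Algebra.Algebra"
begin

inductive_set semigroup_generate :: "('a, 'b) monoid_scheme \<Rightarrow> 'a set \<Rightarrow> 'a set"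
  for G and S where
  incl: "x \<in> S \<Longrightarrow> x \<in> semigroup_generate G S"
| mult: "x \<in> semigroup_generate G S \<Longrightarrow> y \<in> semigroup_generate G S
          \<Longrightarrow> x \<otimes>\<^bsub>G\<^esub> y \<in> semigroup_generate G S"

definition finitely_generated_group :: "('a, 'b) monoid_scheme \<Rightarrow> bool" where
  "finitely_generated_group G \<longleftrightarrow>
     (\<exists>S. finite S \<and> S \<subseteq> carrier G \<and> generate G S = carrier G)"

(* Both minima range over finite generating sets only, because card assigns 0 to infinite sets.
   For a finitely generated group such sets exist and realise the minimal cardinality. *)

definition semigroup_rank :: "('a, 'b) monoid_scheme \<Rightarrow> nat" where
  "semigroup_rank G =
     (LEAST n. \<exists>S. finite S \<and> S \<subseteq> carrier G \<and> semigroup_generate G S = carrier G \<and> card S = n)"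

definition group_rank :: "('a, 'b) monoid_scheme \<Rightarrow> nat" where
  "group_rank G =
     (LEAST n. \<exists>S. finite S \<and> S \<subseteq> carrier G \<and> generate G S = carrier G \<and> card S = n)"

definition torsion_free_group :: "('a, 'b) monoid_scheme \<Rightarrow> bool" where
  "torsion_free_group G \<longleftrightarrow>
     (\<forall>x\<in>carrier G. (\<exists>n::nat. n > 0 \<and> x [^]\<^bsub>G\<^esub> n = \<one>\<^bsub>G\<^esub>) \<longrightarrow> x = \<one>\<^bsub>G\<^esub>)"

end

theory Submission
  imports Defs
begin

text \<open>Write a relation of a finite set \<open>S\<close> as \<open>(\<Prod>x\<in>S. x ^ f x) = 1\<close> with integer exponents.
A generating set is a semigroup generating set as soon as it has a relation with all exponents
positive, since adding multiples of that relation makes the exponents of any element positive;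
adjoining the inverse of the product of all generators always creates such a relation.

The rank of the group is not changed by inverting a generator or by a transvection
\<open>p \<mapsto> p q ^ e\<close>. A nontrivial torsion element yields a nontrivial relation of a minimal generating
set, and these moves make all its exponents positive. Conversely, if a minimal generating set
generates the group as a semigroup, then the identity yields a nontrivial relation with nonnegative
exponents; Euclidean descent by transvections reduces it to \<open>x ^ k = 1\<close> for a single generator \<open>x\<close>,
so in a torsion-free group \<open>x = 1\<close> is redundant, which contradicts minimality.\<close>

section \<open>Minimal generating sets and the two ranks\<close>

definition min_generating :: "('a, 'b) monoid_scheme \<Rightarrow> 'a set \<Rightarrow> bool" where
  "min_generating G S \<longleftrightarrow>
     finite S \<and> S \<subseteq> carrier G \<and> generate G S = carrier G \<and> card S = group_rank G"

lemma min_generatingD: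
  assumes "min_generating G S"
  shows "finite S" "S \<subseteq> carrier G" "generate G S = carrier G" "card S = group_rank G"
  using assms by (auto simp: min_generating_def)

lemma group_rank_le:
  assumes "finite S" "S \<subseteq> carrier G" "generate G S = carrier G"
  shows "group_rank G \<le> card S"
  unfolding group_rank_def using assms by (auto intro: Least_le)

lemma semigroup_rank_le:
  assumes "finite S" "S \<subseteq> carrier G" "semigroup_generate G S = carrier G"
  shows "semigroup_rank G \<le> card S"
  unfolding semigroup_rank_def using assms by (auto intro: Least_le)

lemma min_generating_exists:
  assumes "finitely_generated_group G"
  obtains S where "min_generating G S"
proof -
  have "\<exists>n S. finite S \<and> S \<subseteq> carrier G \<and> generate G S = carrier G \<and> card S = n"
    using assms unfolding finitely_generated_group_def by blast
  from LeastI_ex[OF this] show thesis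
    using that unfolding min_generating_def group_rank_def by blast
qed

lemma semigroup_generate_subset_generate:
  "semigroup_generate G S \<subseteq> generate G S"
proof
  fix x assume "x \<in> semigroup_generate G S"
  then show "x \<in> generate G S"
    by induction (auto intro: generate.intros)
qed

section \<open>Products of integer powers over a finite set\<close>

context comm_group
begin

abbreviation comb :: "'a set \<Rightarrow> ('a \<Rightarrow> int) \<Rightarrow> 'a" where
  "comb S f \<equiv> finprod G (\<lambda>x. x [^] f x) S"

lemma comb_add:
  assumes "S \<subseteq> carrier G"
  shows "comb S (\<lambda>x. f x + g x) = comb S f \<otimes> comb S g"
proof -
  have "comb S (\<lambda>x. f x + g x) = finprod G (\<lambda>x. x [^] f x \<otimes> x [^] g x) S"
    by (rule finprod_cong') (use assms in \<open>auto simp: int_pow_mult\<close>)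
  also have "\<dots> = comb S f \<otimes> comb S g"
    by (rule finprod_multf) (use assms in auto)
  finally show ?thesis .
qed

lemma comb_closed [simp]: "S \<subseteq> carrier G \<Longrightarrow> comb S f \<in> carrier G"
  by (rule finprod_closed) auto

lemma comb_scale:
  assumes "S \<subseteq> carrier G"
  shows "comb S (\<lambda>x. int n * f x) = comb S f [^] n"
proof (induction n)
  case (Suc n)
  have "comb S (\<lambda>x. int (Suc n) * f x) = comb S (\<lambda>x. int n * f x + f x)"
    by (simp add: algebra_simps)
  then show ?case
    using Suc comb_add[OF assms, of "\<lambda>x. int n * f x" f] by simp
qed simp

lemma comb_insert:
  assumes "finite S" "S \<subseteq> carrier G" "x \<in> carrier G" "x \<notin> S"
  shows "comb (insert x S) f = x [^] f x \<otimes> comb S f"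
  using assms by (intro finprod_insert) auto

lemma comb_remove:
  assumes "finite S" "S \<subseteq> carrier G" "x \<in> S"
  shows "comb S f = x [^] f x \<otimes> comb (S - {x}) f"
  using comb_insert[of "S - {x}" x f] assms by (auto simp: insert_absorb)

lemma comb_cong:
  assumes "S \<subseteq> carrier G" "\<And>x. x \<in> S \<Longrightarrow> f x = g x"
  shows "comb S f = comb S g"
  by (rule finprod_cong') (use assms in auto)

lemma comb_single:
  assumes "finite S" "S \<subseteq> carrier G" "x \<in> S" "\<And>y. y \<in> S \<Longrightarrow> y \<noteq> x \<Longrightarrow> f y = 0"
  shows "comb S f = x [^] f x"
proof -
  have "comb (S - {x}) f = comb (S - {x}) (\<lambda>_. 0)"
    by (rule comb_cong) (use assms in auto)
  then show ?thesis
    using comb_remove[OF assms(1-3), of f] assms(2,3) by (auto simp: subset_iff)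
qed

lemma generate_imp_comb:
  assumes "finite S" "S \<subseteq> carrier G" "t \<in> generate G S"
  shows "\<exists>f. t = comb S f"
  using assms(3)
proof induction
  case one
  show ?case by (rule exI[of _ "\<lambda>_. 0"]) simp
next
  case (incl h)
  have "comb S (\<lambda>x. if x = h then 1 else 0) = h"
    using comb_single[OF assms(1,2) incl] assms(2) incl by auto
  then show ?case by metis
next
  case (inv h)
  have "comb S (\<lambda>x. if x = h then -1 else 0) = inv h"
    using comb_single[OF assms(1,2) inv] assms(2) inv by (auto simp: int_pow_neg)
  then show ?case by metis
next
  case (eng h1 h2)
  then show ?case using comb_add[OF assms(2)] by metis
qed

section \<open>Semigroup generation and signs of exponents\<close>

text \<open>An element of the semigroup is a nonempty product, so some exponent is strictly
  positive. Applied to the identity, this yields a nontrivial relation.\<close>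

lemma semigroup_generate_imp_comb:
  assumes "finite S" "S \<subseteq> carrier G" "t \<in> semigroup_generate G S"
  shows "\<exists>f. t = comb S f \<and> (\<forall>x\<in>S. f x \<ge> 0) \<and> (\<exists>x\<in>S. f x > 0)"
  using assms(3)
proof induction
  case (incl h)
  let ?f = "\<lambda>x. if x = h then 1 else (0::int)"
  have "comb S ?f = h"
    using comb_single[OF assms(1,2) incl] assms(2) incl by auto
  then show ?case using incl by (intro exI[of _ ?f]) auto
next
  case (mult x y)
  then obtain f g where fg: "x = comb S f" "\<forall>x\<in>S. f x \<ge> 0" "\<exists>x\<in>S. f x > 0"
    "y = comb S g" "\<forall>x\<in>S. g x \<ge> 0" by blast
  then have "x \<otimes> y = comb S (\<lambda>x. f x + g x)" "\<forall>x\<in>S. f x + g x \<ge> 0"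
    using comb_add[OF assms(2), of f g] by auto
  moreover have "\<exists>x\<in>S. f x + g x > 0"
    using fg by (meson add_pos_nonneg)
  ultimately show ?case by (intro exI[of _ "\<lambda>x. f x + g x"]) blast
qed

lemma semigroup_generate_int_pow:
  assumes "S \<subseteq> carrier G" "x \<in> S" "k > (0::int)"
  shows "x [^] k \<in> semigroup_generate G S"
  using assms(3)
proof (induction k rule: int_gr_induct)
  case base
  have "x \<in> carrier G" using assms by auto
  then show ?case using assms by (simp add: semigroup_generate.incl)
next
  case (step i)
  have "x \<in> carrier G" using assms by auto
  then have "x [^] (i + 1) = x [^] i \<otimes> x" by (simp add: int_pow_mult)
  then show ?case using step.IH assms(2) by (auto intro: semigroup_generate.intros)
qed

text \<open>The semigroup is not known to contain the identity, so zero exponents and the empty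
  product are excluded, and the induction runs over nonempty subsets.\<close>

lemma comb_pos_in_semigroup_generate:
  assumes "finite S" "S \<subseteq> carrier G" "S \<noteq> {}" "\<And>x. x \<in> S \<Longrightarrow> f x > 0"
  shows "comb S f \<in> semigroup_generate G S"
proof -
  have "T \<subseteq> S \<Longrightarrow> comb T f \<in> semigroup_generate G S" if "finite T" "T \<noteq> {}" for T
    using that
  proof (induction T rule: finite_ne_induct)
    case (singleton x)
    then have "comb {x} f = x [^] f x"
      using assms(2) by (intro comb_single) auto
    then show ?case using semigroup_generate_int_pow assms singleton by auto
  next
    case (insert x T)
    then have "comb (insert x T) f = x [^] f x \<otimes> comb T f"
      using assms(2) by (intro comb_insert) auto
    then show ?case
      using insert assms by (auto intro!: semigroup_generate.mult semigroup_generate_int_pow)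
  qed
  then show ?thesis using assms by blast
qed

lemma semigroup_generate_eq_carrier_of_pos_relation:
  assumes "finite S" "S \<subseteq> carrier G" "S \<noteq> {}" "generate G S = carrier G"
    and "\<And>x. x \<in> S \<Longrightarrow> f x > 0" "comb S f = \<one>"
  shows "semigroup_generate G S = carrier G"
proof
  show "semigroup_generate G S \<subseteq> carrier G"
    using semigroup_generate_subset_generate[of G S] assms(4) by simp
next
  show "carrier G \<subseteq> semigroup_generate G S"
  proof
    fix t assume "t \<in> carrier G"
    then obtain h where h: "t = comb S h"
      using generate_imp_comb[OF assms(1,2)] assms(4) by blast
    \<comment> \<open>\<open>N\<close> exceeds every \<open>\<bar>h x\<bar>\<close> on
      \<open>S\<close>; since each \<open>f x\<close> is at least 1, adding \<open>N\<close> times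
      the relation makes all exponents positive.\<close>
    define N where "N = nat (1 + (\<Sum>x\<in>S. \<bar>h x\<bar>))"
    have "comb S (\<lambda>x. h x + int N * f x) = t"
      using assms(2) h comb_scale[OF assms(2), of N f] assms(6)
        comb_add[OF assms(2), of h "\<lambda>x. int N * f x"] by simp
    moreover have "h x + int N * f x > 0" if "x \<in> S" for x
    proof -
      have "\<bar>h x\<bar> \<le> (\<Sum>x\<in>S. \<bar>h x\<bar>)"
        using assms(1) that by (intro member_le_sum) auto
      then have "\<bar>h x\<bar> < int N" unfolding N_def by linarith
      moreover have "int N * 1 \<le> int N * f x"
        using assms(5)[OF that] by (intro mult_left_mono) auto
      ultimately show ?thesis by linarith
    qed
    ultimately show "t \<in> semigroup_generate G S"
      using comb_pos_in_semigroup_generate[OF assms(1-3), of "\<lambda>x. h x + int N * f x"] by simp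
  qed
qed

section \<open>Moves between minimal generating sets\<close>

lemma generate_insert_absorb:
  assumes "A \<subseteq> carrier G" "x \<in> generate G A"
  shows "generate G (insert x A) = generate G A"
proof
  have "insert x A \<subseteq> generate G A"
    using assms(2) by (auto intro: generate.incl)
  then show "generate G (insert x A) \<subseteq> generate G A"
    using generate_subgroup_incl generate_is_subgroup[OF assms(1)] by blast
  show "generate G A \<subseteq> generate G (insert x A)"
    by (rule mono_generate) blast
qed

text \<open>If \<open>y\<close> were already in \<open>S - {x}\<close>, that smaller set would still
  generate, against minimality. Hence \<open>y\<close> is a fresh element, and redefining an
  exponent function at \<open>y\<close> overwrites none of the other exponents.\<close>

lemma min_generating_exchange:
  assumes S: "min_generating G S" and x: "x \<in> S" and y: "y \<in> carrier G"
    and gen: "x \<in> generate G (insert y (S - {x}))"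
  shows "min_generating G (insert y (S - {x}))" "y \<notin> S - {x}"
proof -
  let ?T = "insert y (S - {x})"
  note D = min_generatingD[OF S]
  have T: "finite ?T" "?T \<subseteq> carrier G" using D y by auto
  have "carrier G \<subseteq> generate G (insert x ?T)"
    using mono_generate[of S "insert x ?T"] D(3) by auto
  then have gT: "generate G ?T = carrier G"
    using generate_insert_absorb[OF T(2) gen] generate_incl[OF T(2)] by auto
  then have le: "card S \<le> card ?T" using group_rank_le[OF T] D(4) by simp
  show y: "y \<notin> S - {x}"
  proof
    assume "y \<in> S - {x}"
    then have "?T = S - {x}" by auto
    then show False using le card_Diff1_less[OF D(1) x] by (metis leD)
  qed
  have "card ?T = card S" using y D(1) x card_Suc_Diff1[OF D(1) x] by simp
  then show "min_generating G ?T"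
    using T gT D by (auto simp: min_generating_def)
qed

text \<open>From \<open>p = y \<otimes> q [^] (- e)\<close>, the factor \<open>p [^] f p\<close>
  contributes \<open>f p\<close> to the exponent of \<open>y\<close> and \<open>- e * f p\<close> to
  that of \<open>q\<close>. So a product keeps its value under the new exponents.\<close>

lemma min_generating_transvection:
  fixes e :: int
  assumes S: "min_generating G S" and p: "p \<in> S" and q: "q \<in> S" and "p \<noteq> q"
  defines "y \<equiv> p \<otimes> q [^] e"
  shows "min_generating G (insert y (S - {p}))" "y \<notin> S - {p}"
    "comb (insert y (S - {p})) (f(q := f q - e * f p, y := f p)) = comb S f"
proof -
  note D = min_generatingD[OF S]
  let ?T = "insert y (S - {p})"
  let ?f = "f(q := f q - e * f p, y := f p)"
  have c: "p \<in> carrier G" "q \<in> carrier G" "y \<in> carrier G"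
    using D p q by (auto simp: y_def)
  have sub: "subgroup (generate G ?T) G"
    using D c by (intro generate_is_subgroup) auto
  have yq: "y \<in> generate G ?T" "q \<in> generate G ?T"
    using q \<open>p \<noteq> q\<close> by (auto intro: generate.incl)
  have "p = y \<otimes> q [^] (- e)"
    using c by (simp add: y_def m_assoc int_pow_neg)
  then have "p \<in> generate G ?T"
    using yq subgroup.m_closed[OF sub] subgroup_int_pow_closed[OF sub] by metis
  note E = min_generating_exchange[OF S p c(3) this]
  show "min_generating G ?T" and y: "y \<notin> S - {p}" by (fact E)+
  \<comment> \<open>Without this, the outer update at \<open>y\<close> would overwrite the new
    exponent of \<open>q\<close>.\<close>
  have yq': "y \<noteq> q" using y q \<open>p \<noteq> q\<close> by auto
  let ?R = "S - {p} - {q}"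
  have R: "finite ?R" "?R \<subseteq> carrier G" using D by auto
  have "comb ?T ?f = y [^] ?f y \<otimes> comb (S - {p}) ?f"
    using D c y by (intro comb_insert) auto
  also have "comb (S - {p}) ?f = q [^] ?f q \<otimes> comb ?R ?f"
    using D q \<open>p \<noteq> q\<close> by (intro comb_remove) auto
  also have "comb ?R ?f = comb ?R f"
    using R y by (intro comb_cong) auto
  also have "y [^] ?f y \<otimes> (q [^] ?f q \<otimes> comb ?R f) =
      p [^] f p \<otimes> (q [^] (e * f p) \<otimes> q [^] (f q - e * f p)) \<otimes> comb ?R f"
    using c R yq' by (simp add: y_def int_pow_distrib int_pow_pow m_assoc)
  also have "q [^] (e * f p) \<otimes> q [^] (f q - e * f p) = q [^] f q"
    using c by (simp flip: int_pow_mult)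
  also have "p [^] f p \<otimes> q [^] f q \<otimes> comb ?R f = p [^] f p \<otimes> (q [^] f q \<otimes> comb ?R f)"
    using c R by (simp add: m_assoc)
  also have "q [^] f q \<otimes> comb ?R f = comb (S - {p}) f"
    using D q \<open>p \<noteq> q\<close> by (intro comb_remove[symmetric]) auto
  also have "p [^] f p \<otimes> comb (S - {p}) f = comb S f"
    using D p by (intro comb_remove[symmetric]) auto
  finally show "comb ?T ?f = comb S f" .
qed

lemma min_generating_invert:
  assumes S: "min_generating G S" and p: "p \<in> S"
  shows "min_generating G (insert (inv p) (S - {p}))" "inv p \<notin> S - {p}"
    "comb (insert (inv p) (S - {p})) (f(inv p := - f p)) = comb S f"
proof -
  note D = min_generatingD[OF S]
  let ?T = "insert (inv p) (S - {p})"
  have c: "p \<in> carrier G" using D p by auto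
  have "inv (inv p) \<in> generate G ?T" by (intro generate.inv) simp
  then have "p \<in> generate G ?T" using c by simp
  note E = min_generating_exchange[OF S p inv_closed[OF c] this]
  show "min_generating G ?T" and y: "inv p \<notin> S - {p}" by (fact E)+
  have "comb ?T (f(inv p := - f p)) = inv p [^] (- f p) \<otimes> comb (S - {p}) (f(inv p := - f p))"
    using comb_insert[of "S - {p}" "inv p" "f(inv p := - f p)"] D c y by auto
  also have "comb (S - {p}) (f(inv p := - f p)) = comb (S - {p}) f"
    using D y by (intro comb_cong) auto
  also have "inv p [^] (- f p) = p [^] f p"
    using c by (simp add: int_pow_neg int_pow_inv)
  also have "p [^] f p \<otimes> comb (S - {p}) f = comb S f"
    using D p by (intro comb_remove[symmetric]) auto
  finally show "comb ?T (f(inv p := - f p)) = comb S f" .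
qed

section \<open>Transforming relations of minimal generating sets\<close>

text \<open>Induction on the number of nonpositive exponents. Inverting a generator repairs a
  negative exponent; a transvection with a generator of positive exponent repairs a zero
  one.\<close>

lemma min_generating_pos_relation:
  assumes "min_generating G S" "comb S f = \<one>" "\<exists>x\<in>S. f x \<noteq> 0"
  shows "\<exists>T g. min_generating G T \<and> comb T g = \<one> \<and> (\<forall>x\<in>T. g x > 0)"
  using assms
proof (induction "card {x \<in> S. f x \<le> 0}" arbitrary: S f rule: less_induct)
  case less
  note D = min_generatingD[OF less.prems(1)]
  have card_less: "card A < card {x \<in> S. f x \<le> 0}"
    if "A \<subseteq> {x \<in> S. f x \<le> 0} - {z}" "z \<in> S" "f z \<le> 0" for A z
    using that D(1) by (intro psubset_card_mono) auto
  \<comment> \<open>If no exponent is negative, the nonzero one supplied by the hypothesis is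
    positive and serves as \<open>f p\<close>.\<close>
  consider "\<forall>x\<in>S. f x > 0" | z where "z \<in> S" "f z < 0"
    | p z where "p \<in> S" "f p > 0" "z \<in> S" "f z = 0"
    using less.prems(3) by (metis linorder_neqE_linordered_idom)
  then show ?case
  proof cases
    case 1
    then show ?thesis using less.prems by blast
  next
    case 2
    let ?f = "f(inv z := - f z)" and ?T = "insert (inv z) (S - {z})"
    note I = min_generating_invert[OF less.prems(1) 2(1)]
    have "{x \<in> ?T. ?f x \<le> 0} \<subseteq> {x \<in> S. f x \<le> 0} - {z}"
      using 2(2) by (intro subsetI) (simp split: if_splits)
    then have "card {x \<in> ?T. ?f x \<le> 0} < card {x \<in> S. f x \<le> 0}"
      using card_less 2 by simp
    moreover have "\<exists>x\<in>?T. ?f x \<noteq> 0" using 2 by simp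
    moreover have "comb ?T ?f = \<one>" using I(3) less.prems(2) by (rule trans)
    ultimately show ?thesis by (intro less.hyps[OF _ I(1), of ?f])
  next
    case 3
    \<comment> \<open>With \<open>e = -1\<close> the exponent of \<open>z\<close> rises from 0 to
      \<open>f p\<close>, while the new generator \<open>?y\<close> carries \<open>f p\<close> as
      well.\<close>
    let ?y = "p \<otimes> z [^] (-1::int)"
    let ?f = "f(z := f z - (-1) * f p, ?y := f p)" and ?T = "insert ?y (S - {p})"
    have "p \<noteq> z" using 3 by auto
    note I = min_generating_transvection[OF less.prems(1) 3(1,3) this, where e = "-1"]
    have "?y \<noteq> z" using I(2) 3 \<open>p \<noteq> z\<close> by auto
    then have "{x \<in> ?T. ?f x \<le> 0} \<subseteq> {x \<in> S. f x \<le> 0} - {z}"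
      using 3(2,4) by (intro subsetI) (simp split: if_splits)
    then have "card {x \<in> ?T. ?f x \<le> 0} < card {x \<in> S. f x \<le> 0}"
      using card_less 3(3,4) by simp
    moreover have "\<exists>x\<in>?T. ?f x \<noteq> 0" using 3(2) by simp
    moreover have "comb ?T ?f = \<one>" using I(3) less.prems(2) by (rule trans)
    ultimately show ?thesis by (intro less.hyps[OF _ I(1), of ?f])
  qed
qed

text \<open>Descent on the sum of the exponents: two positive exponents allow a subtractive
  Euclidean step, and a single one gives a torsion generator.\<close>

lemma torsion_free_min_generating_no_nonneg_relation:
  assumes "torsion_free_group G" "min_generating G S" "comb S f = \<one>"
    "\<forall>x\<in>S. f x \<ge> 0" "\<exists>x\<in>S. f x > 0"
  shows False
  using assms(2-)
proof (induction "nat (sum f S)" arbitrary: S f rule: less_induct)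
  case less
  note D = min_generatingD[OF less.prems(1)]
  obtain a where a: "a \<in> S" "f a > 0" using less.prems by blast
  show False
  proof (cases "\<exists>b\<in>S. b \<noteq> a \<and> f b > 0")
    case False
    then have "comb S f = a [^] f a"
      using D a less.prems(3) by (intro comb_single) force+
    then have "a [^] nat (f a) = \<one>"
      using less.prems(2) a(2) by (metis int_pow_int nat_0_le less_imp_le)
    then have "a = \<one>"
      using assms(1) a D(2) unfolding torsion_free_group_def
      by (metis subsetD zero_less_nat_eq)
    \<comment> \<open>The identity lies in every generated subgroup, so it could be dropped from
      \<open>S\<close>, against minimality.\<close>
    moreover have "\<one> \<notin> S"
    proof
      assume "\<one> \<in> S"
      then have "generate G (S - {\<one>}) = carrier G"
        using generate_insert_absorb[of "S - {\<one>}" \<one>] D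
        by (auto simp: insert_absorb intro: generate.one)
      then have "card S \<le> card (S - {\<one>})"
        using group_rank_le[of "S - {\<one>}" G] D by auto
      then show False using card_Diff1_less[OF D(1) \<open>\<one> \<in> S\<close>] by simp
    qed
    ultimately show False using a by simp
  next
    case True
    \<comment> \<open>Of two generators with positive exponents, \<open>p\<close> is one with the
      smaller exponent. Subtracting \<open>f p\<close> from \<open>f q\<close> then keeps all
      exponents nonnegative and lowers the sum by \<open>f p\<close>.\<close>
    then obtain p q where pq: "p \<in> S" "q \<in> S" "p \<noteq> q" "f p > 0" "f p \<le> f q"
      using a by (metis linear)
    let ?y = "p \<otimes> q [^] (1::int)"
    let ?f = "f(q := f q - 1 * f p, ?y := f p)" and ?T = "insert ?y (S - {p})"
    note I = min_generating_transvection[OF less.prems(1) pq(1-3), where e = 1]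
    have yq: "?y \<noteq> q" using I(2) pq by auto
    have "sum ?f ?T = ?f ?y + (?f q + sum ?f (S - {p} - {q}))"
      using D pq I(2) by (simp add: sum.remove[of "S - {p}" q])
    also have "sum ?f (S - {p} - {q}) = sum f (S - {p} - {q})"
      using I(2) by (intro sum.cong) auto
    also have "?f ?y + (?f q + sum f (S - {p} - {q})) = f q + sum f (S - {p} - {q})"
      using yq by simp
    finally have "sum ?f ?T = f q + sum f (S - {p} - {q})" .
    moreover have "sum f S = f p + (f q + sum f (S - {p} - {q}))"
      using D pq by (simp add: sum.remove[of S p] sum.remove[of "S - {p}" q])
    ultimately have "sum ?f ?T = sum f S - f p" by simp
    moreover have "f p \<le> sum f S"
      using D pq less.prems(3) by (intro member_le_sum) auto
    ultimately have "nat (sum ?f ?T) < nat (sum f S)" using pq by simp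
    moreover have "\<forall>x\<in>?T. ?f x \<ge> 0" using less.prems(3) pq by auto
    moreover have "\<exists>x\<in>?T. ?f x > 0" using pq by auto
    moreover have "comb ?T ?f = \<one>" using I(3) less.prems(2) by (rule trans)
    ultimately show False by (intro less.hyps[OF _ I(1), of ?f])
  qed
qed

section \<open>The upper bound for the semigroup rank\<close>

text \<open>The adjoined inverse \<open>y\<close> of the product may already lie in
  \<open>S\<close>, hence an inequality. For empty \<open>S\<close> it is the identity, which makes
  the set nonempty.\<close>

lemma ex_semigroup_generating_card_le_Suc_group_rank:
  assumes "min_generating G S"
  shows "\<exists>T. finite T \<and> T \<subseteq> carrier G \<and> semigroup_generate G T = carrier G
      \<and> card T \<le> group_rank G + 1"
proof -
  note D = min_generatingD[OF assms]
  define y where "y = inv (comb S (\<lambda>_. 1))"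
  let ?T = "insert y S"
  \<comment> \<open>If \<open>y\<close> is already a generator, its own exponent 1 and that of the
    adjoined factor add up to 2.\<close>
  let ?f = "if y \<in> S then (\<lambda>_. (1::int))(y := 2) else (\<lambda>_. 1)"
  have y: "y \<in> carrier G" unfolding y_def using D by (intro inv_closed comb_closed)
  have T: "finite ?T" "?T \<subseteq> carrier G" "?T \<noteq> {}" using D y by auto
  have c1: "y \<otimes> comb S (\<lambda>_. 1) = \<one>"
    unfolding y_def using D by (intro l_inv comb_closed)
  have "comb ?T ?f = \<one>"
  proof (cases "y \<in> S")
    case True
    let ?g = "\<lambda>x. if x = y then 1 else (0::int)"
    have "comb S ?g = y"
      using comb_single[OF D(1,2) True, of ?g] y by auto
    then have "comb S (\<lambda>x. ?g x + 1) = \<one>"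
      using comb_add[OF D(2), of ?g "\<lambda>_. 1"] c1 by simp
    moreover have "comb S (\<lambda>x. ?g x + 1) = comb S ?f"
      using D True by (intro comb_cong) auto
    ultimately show ?thesis using True by (simp add: insert_absorb)
  next
    case False
    then show ?thesis using comb_insert[OF D(1,2) y False, of ?f] y c1 by simp
  qed
  moreover have "generate G ?T = carrier G"
    using generate_insert_absorb[OF D(2)] D(3) y by simp
  moreover have "?f x > 0" if "x \<in> ?T" for x by simp
  ultimately have "semigroup_generate G ?T = carrier G"
    using semigroup_generate_eq_carrier_of_pos_relation[OF T] by blast
  moreover have "card ?T \<le> group_rank G + 1"
    using D by (simp add: card_insert_if)
  ultimately show ?thesis using T by blast
qed

end

theorem corollary4p3:
  fixes G :: "('a, 'b) monoid_scheme"
  assumes "comm_group G" and "finitely_generated_group G"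
  shows "(torsion_free_group G \<longrightarrow> semigroup_rank G = group_rank G + 1) \<and>
         (\<not> torsion_free_group G \<longrightarrow> semigroup_rank G = group_rank G)"
proof -
  interpret comm_group G by fact
  obtain S where S: "min_generating G S"
    using min_generating_exists assms(2) by blast
  note D = min_generatingD[OF S]
  obtain T where T: "finite T" "T \<subseteq> carrier G" "semigroup_generate G T = carrier G"
    "card T \<le> group_rank G + 1"
    using ex_semigroup_generating_card_le_Suc_group_rank[OF S] by blast
  then have upper: "semigroup_rank G \<le> group_rank G + 1"
    using semigroup_rank_le[of T G] by simp
  have "\<exists>n S. finite S \<and> S \<subseteq> carrier G \<and> semigroup_generate G S = carrier G \<and> card S = n"
    using T by blast
  from LeastI_ex[OF this] obtain U where U: "finite U" "U \<subseteq> carrier G"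
    "semigroup_generate G U = carrier G" "card U = semigroup_rank G"
    unfolding semigroup_rank_def by blast
  have gU: "generate G U = carrier G"
    using semigroup_generate_subset_generate[of G U] generate_incl[OF U(2)] U(3) by blast
  then have lower: "group_rank G \<le> semigroup_rank G"
    using group_rank_le[OF U(1,2)] U(4) by simp
  have "semigroup_rank G = group_rank G + 1" if tf: "torsion_free_group G"
  proof (rule ccontr)
    assume "\<not> ?thesis"
    \<comment> \<open>The bounds \<open>lower\<close> and \<open>upper\<close> leave only equality
      of the ranks, so the optimal semigroup generating set \<open>U\<close> is also a minimal group
      generating set.\<close>
    then have "min_generating G U"
      using upper lower U gU by (auto simp: min_generating_def)
    moreover obtain f where "\<one>\<^bsub>G\<^esub> = comb U f" "\<forall>x\<in>U. f x \<ge> 0" "\<exists>x\<in>U. f x > 0"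
      using semigroup_generate_imp_comb[OF U(1,2), of "\<one>\<^bsub>G\<^esub>"] U(3) by auto
    ultimately show False
      using torsion_free_min_generating_no_nonneg_relation[OF tf] by metis
  qed
  moreover have "semigroup_rank G = group_rank G" if ntf: "\<not> torsion_free_group G"
  proof -
    obtain t and m :: nat where t: "t \<in> carrier G" "t \<noteq> \<one>\<^bsub>G\<^esub>" "m > 0" "t [^]\<^bsub>G\<^esub> m = \<one>\<^bsub>G\<^esub>"
      using ntf unfolding torsion_free_group_def by blast
    obtain b where b: "t = comb S b"
      using generate_imp_comb[OF D(1,2)] D(3) t(1) by blast
    \<comment> \<open>If all exponents vanished on \<open>S\<close>, \<open>t\<close> would be the
      identity. Multiplying them by \<open>m\<close> then expresses \<open>t [^] m = \<one>\<close>
      as a nontrivial relation.\<close>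
    have "\<exists>x\<in>S. b x \<noteq> 0"
      using b t(2) comb_cong[OF D(2), of b "\<lambda>_. 0"] by auto
    then have nz: "\<exists>x\<in>S. int m * b x \<noteq> 0" using t(3) by auto
    then obtain V g where V: "min_generating G V" "comb V g = \<one>\<^bsub>G\<^esub>" "\<forall>x\<in>V. g x > 0"
      using min_generating_pos_relation[OF S, of "\<lambda>x. int m * b x"] comb_scale[OF D(2), of m b]
        b t(4) by auto
    note DV = min_generatingD[OF V(1)]
    \<comment> \<open>The nontrivial relation shows that \<open>S\<close> is nonempty, and
      \<open>V\<close> has the same cardinality.\<close>
    have "V \<noteq> {}" using nz D(1,4) DV(4) by (metis card.empty card_0_eq empty_iff)
    then have "semigroup_generate G V = carrier G"
      using semigroup_generate_eq_carrier_of_pos_relation[OF DV(1,2) _ DV(3), of g] V by blast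
    then show ?thesis
      using semigroup_rank_le[OF DV(1,2)] DV(4) lower by simp
  qed
  ultimately show ?thesis by blast
qed

end
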